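(* Let $G$ be a weighted directed graph on $n$ vertices with $m$ edges whose Laplacian $L$ is an Eulerian Laplacian with every diagonal entry $L_{ii} > 0$, and let $\alpha \ge 0$. Consider the procedure FindRCDDBlock$(G,\alpha)$: set $F \leftarrow \emptyset$; while $|F| < \frac{n}{16(1+\alpha)}$, let $F$ be a set of $k = \frac{n}{8(1+\alpha)}$ vertices sampled uniformly at random, and then remove from $F$ every vertex $i$ for which $\sum_{j \in F, j\neq i}|L_{ij}| > \frac{1}{1+\alpha}|L_{ii}|$ or $\sum_{j\in F, j\ne i}|L_{ji}| > \frac{1}{1+\alpha}|L_{ii}|$ (the sums being over the sampled set); output the final $F$. Then for every $\delta \in (0,1)$, with probability at least $1-O(\delta)$ the procedure runs in time $O(m\log(1/\delta))$ and outputs an $\alpha$-RCDD set of vertices of size at least $\frac{n}{16(1+\alpha)}$.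
   Context: A matrix $L\in\mathbb{R}^{n\times n}$ is an Eulerian Laplacian if $L_{ij}\le 0$ for $i\ne j$, $\mathbf{1}^\top L = 0$ and $L\mathbf{1}=0$; the associated graph has an edge $(i,j)$ of weight $-L_{ji}$ whenever this is nonzero. A subset $F$ of indices is $\alpha$-RCDD (for $L$) if for every $i \in F$, $\sum_{j\in F, j\ne i}|L_{ij}| \le \frac{1}{1+\alpha}|L_{ii}|$ and $\sum_{j \in F, j \ne i}|L_{ji}|\le \frac{1}{1+\alpha}|L_{ii}|$. *)

theory Defs
  imports "HOL-Probability.SPMF" "Jordan_Normal_Form.Matrix"
begin

definition eulerian_laplacian :: "nat \<Rightarrow> real mat \<Rightarrow> bool" where
  "eulerian_laplacian n L \<longleftrightarrow>
     L \<in> carrier_mat n n \<and>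
     (\<forall>i<n. \<forall>j<n. i \<noteq> j \<longrightarrow> L $$ (i, j) \<le> 0) \<and>
     L\<^sup>T *\<^sub>v vec n (\<lambda>_. 1) = 0\<^sub>v n \<and>
     L *\<^sub>v vec n (\<lambda>_. 1) = 0\<^sub>v n"

definition rcdd :: "real mat \<Rightarrow> real \<Rightarrow> nat set \<Rightarrow> bool" where
  "rcdd L \<alpha> F \<longleftrightarrow>
     F \<subseteq> {..<dim_row L} \<and>
     (\<forall>i\<in>F. (\<Sum>j\<in>F - {i}. \<bar>L $$ (i, j)\<bar>) \<le> 1 / (1 + \<alpha>) * \<bar>L $$ (i, i)\<bar> \<and>
            (\<Sum>j\<in>F - {i}. \<bar>L $$ (j, i)\<bar>) \<le> 1 / (1 + \<alpha>) * \<bar>L $$ (i, i)\<bar>)"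

text \<open>
  The graph of a Laplacian is given as a duplicate-free list of edges: a triple
  \<open>(i, j, w)\<close> is an edge from \<open>i\<close> to \<open>j\<close> of weight \<open>w\<close>. The
  order of the list is arbitrary. Diagonal entries do not contribute edges.
\<close>

type_synonym edge_list = "(nat \<times> nat \<times> real) list"

definition graph_of :: "real mat \<Rightarrow> edge_list \<Rightarrow> bool" where
  "graph_of L G \<longleftrightarrow>
     distinct G \<and>
     set G = {(i, j, w). i < dim_row L \<and> j < dim_row L \<and> i \<noteq> j \<and> w = - L $$ (j, i) \<and> w \<noteq> 0}"

text \<open>
  The procedure below works on the edge list only. Running time is counted in the unit-cost
  RAM model, up to a constant factor: every component \<open>t\<close> is a step counter, and one step
  is one pass through the body of a loop over vertices or edges, which performs a bounded number
  of arithmetic operations, comparisons and array accesses. Functions on vertices and vertex sets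
  stand for arrays of length \<open>n\<close>; initialising such an array takes \<open>n\<close> steps.
\<close>

text \<open>
  Weighted out-degrees. The columns of \<open>L\<close> sum to zero, so these are the diagonal
  entries of \<open>L\<close> (see \<open>degrees_eq_diag\<close>).
\<close>

definition degrees :: "nat \<Rightarrow> edge_list \<Rightarrow> (nat \<Rightarrow> real) \<times> nat" where
  "degrees n G = fold (\<lambda>(i, j, w) (d, t). (d(i := d i + w), t + 1)) G (\<lambda>_. 0, n)"

text \<open>
  For all \<open>i \<in> S\<close> at once, the off-diagonal absolute row sums \<open>r i\<close> and column
  sums \<open>c i\<close> of the submatrix of \<open>L\<close> indexed by \<open>S\<close>. An edge
  \<open>(i, j, w)\<close> comes from the entry in row \<open>j\<close> and column \<open>i\<close>.
\<close>

definition row_col_sums ::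
  "nat \<Rightarrow> edge_list \<Rightarrow> nat set \<Rightarrow> (nat \<Rightarrow> real) \<times> (nat \<Rightarrow> real) \<times> nat" where
  "row_col_sums n G S =
     fold (\<lambda>(i, j, w) (r, c, t).
             if i \<in> S \<and> j \<in> S
             then (r(j := r j + \<bar>w\<bar>), c(i := c i + \<bar>w\<bar>), t + 1)
             else (r, c, t + 1))
          G (\<lambda>_. 0, \<lambda>_. 0, 2 * n)"

text \<open>
  The removal step, applied to a sampled set \<open>S\<close>. All sums are over \<open>S\<close>, so that
  removing one vertex does not affect the test for another.
\<close>

definition prune ::
  "nat \<Rightarrow> edge_list \<Rightarrow> real \<Rightarrow> (nat \<Rightarrow> real) \<Rightarrow> nat set \<Rightarrow> nat set \<times> nat" where
  "prune n G \<alpha> d S =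
     (let (r, c, t) = row_col_sums n G S
      in fold (\<lambda>i (F, t).
                 if i \<in> S \<and> \<not> (r i > 1 / (1 + \<alpha>) * \<bar>d i\<bar> \<or> c i > 1 / (1 + \<alpha>) * \<bar>d i\<bar>)
                 then (insert i F, t + 1)
                 else (F, t + 1))
              [0..<n] ({}, t + n))"

text \<open>
  Since \<open>n / (8 * (1 + \<alpha>))\<close> need not be an integer, the sample size is rounded up.
  (Rounding down would give sample size \<open>0\<close>, and hence a loop that never ends, whenever
  \<open>0 < n < 8 * (1 + \<alpha>)\<close>.)
\<close>

definition sample_size :: "nat \<Rightarrow> real \<Rightarrow> nat" where
  "sample_size n \<alpha> = nat \<lceil>real n / (8 * (1 + \<alpha>))\<rceil>"

text \<open>
  The while loop, with current set \<open>F\<close> and \<open>t\<close> steps done so far. Runs that never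
  end make up the missing mass of the subprobability distribution. Testing the loop condition
  takes \<open>n\<close> steps (counting \<open>F\<close>). Drawing a uniformly random set of \<open>k\<close>
  vertices takes \<open>n + k\<close> steps, the cost of setting up an array of all vertices
  and performing \<open>k\<close> steps of a random shuffle.
\<close>

partial_function (spmf) sample_loop ::
  "nat \<Rightarrow> edge_list \<Rightarrow> real \<Rightarrow> (nat \<Rightarrow> real) \<Rightarrow> nat set \<Rightarrow> nat \<Rightarrow> (nat set \<times> nat) spmf"
where
  "sample_loop n G \<alpha> d F t =
     (if real (card F) < real n / (16 * (1 + \<alpha>))
      then bind_spmf (spmf_of_set {S. S \<subseteq> {..<n} \<and> card S = sample_size n \<alpha>})
             (\<lambda>S. let (F', t') = prune n G \<alpha> d S
                   in sample_loop n G \<alpha> d F' (t + n + (n + sample_size n \<alpha>) + t'))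
      else return_spmf (F, t + n))"

definition find_rcdd_block :: "nat \<Rightarrow> edge_list \<Rightarrow> real \<Rightarrow> (nat set \<times> nat) spmf" where
  "find_rcdd_block n G \<alpha> = (let (d, t) = degrees n G in sample_loop n G \<alpha> d {} (t + n))"


subsection \<open>The removal step in terms of the Laplacian\<close>

lemma graph_of_sum_list:
  assumes "graph_of L G"
  shows "sum_list (map f G) =
    (\<Sum>(i, j)\<in>{(i, j). i < dim_row L \<and> j < dim_row L \<and> i \<noteq> j \<and> L $$ (j, i) \<noteq> 0}. f (i, j, - L $$ (j, i)))"
proof -
  let ?E = "{(i, j). i < dim_row L \<and> j < dim_row L \<and> i \<noteq> j \<and> L $$ (j, i) \<noteq> 0}"
  let ?h = "\<lambda>(i, j). (i, j, - L $$ (j, i))"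
  have d: "distinct G" and s: "set G = ?h ` ?E"
    using assms by (auto simp: graph_of_def)
  have "sum_list (map f G) = sum f (set G)"
    using d by (simp add: sum_list_distinct_conv_sum_set)
  also have "\<dots> = sum (f \<circ> ?h) ?E"
    unfolding s by (rule sum.reindex) (auto simp: inj_on_def)
  finally show ?thesis by (simp add: case_prod_unfold comp_def)
qed

lemma graph_of_sum_list_if:
  assumes "graph_of L G" "L \<in> carrier_mat n n" "v < n"
    and "\<And>i j. f (i, j, 0) = (0::real)"
  shows "sum_list (map (\<lambda>(i, j, w). if i = v then f (i, j, w) else 0) G)
           = (\<Sum>j\<in>{..<n} - {v}. f (v, j, - L $$ (j, v)))"
    and "sum_list (map (\<lambda>(i, j, w). if j = v then f (i, j, w) else 0) G)
           = (\<Sum>i\<in>{..<n} - {v}. f (i, v, - L $$ (v, i)))"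
proof -
  let ?E = "{(i, j). i < dim_row L \<and> j < dim_row L \<and> i \<noteq> j \<and> L $$ (j, i) \<noteq> 0}"
  have dim: "dim_row L = n" using assms(2) by auto
  have fin: "finite ?E"
    by (rule finite_subset[of _ "{..<n} \<times> {..<n}"]) (auto simp: dim)
  have "sum_list (map (\<lambda>(i, j, w). if i = v then f (i, j, w) else 0) G)
      = (\<Sum>e\<in>?E. if fst e = v then f (fst e, snd e, - L $$ (snd e, fst e)) else 0)"
    by (subst graph_of_sum_list[OF assms(1)]) (simp add: case_prod_unfold cong: if_cong)
  also have "\<dots> = (\<Sum>e\<in>Pair v ` ({..<n} - {v}). f (fst e, snd e, - L $$ (snd e, fst e)))"
    by (rule sum.mono_neutral_cong) (use fin assms(3,4) dim in \<open>auto split: if_splits\<close>)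
  also have "\<dots> = (\<Sum>j\<in>{..<n} - {v}. f (v, j, - L $$ (j, v)))"
    by (subst sum.reindex) (auto simp: inj_on_def)
  finally show "sum_list (map (\<lambda>(i, j, w). if i = v then f (i, j, w) else 0) G)
           = (\<Sum>j\<in>{..<n} - {v}. f (v, j, - L $$ (j, v)))" .
  have "sum_list (map (\<lambda>(i, j, w). if j = v then f (i, j, w) else 0) G)
      = (\<Sum>e\<in>?E. if snd e = v then f (fst e, snd e, - L $$ (snd e, fst e)) else 0)"
    by (subst graph_of_sum_list[OF assms(1)]) (simp add: case_prod_unfold cong: if_cong)
  also have "\<dots> = (\<Sum>e\<in>(\<lambda>i. (i, v)) ` ({..<n} - {v}). f (fst e, snd e, - L $$ (snd e, fst e)))"
    by (rule sum.mono_neutral_cong) (use fin assms(3,4) dim in \<open>auto split: if_splits\<close>)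
  also have "\<dots> = (\<Sum>i\<in>{..<n} - {v}. f (i, v, - L $$ (v, i)))"
    by (subst sum.reindex) (auto simp: inj_on_def)
  finally show "sum_list (map (\<lambda>(i, j, w). if j = v then f (i, j, w) else 0) G)
           = (\<Sum>i\<in>{..<n} - {v}. f (i, v, - L $$ (v, i)))" .
qed

lemma degrees_fold:
  "fold (\<lambda>(i, j, w) (d, t). (d(i := d i + w), t + 1)) G (d :: nat \<Rightarrow> real, t)
     = ((\<lambda>v. d v + sum_list (map (\<lambda>(i, j, w). if i = v then w else 0) G)), t + length G)"
  by (induction G arbitrary: d t) (auto simp: fun_eq_iff add.assoc)

lemma row_col_sums_fold:
  "fold (\<lambda>(i, j, w) (r, c, t).
             if i \<in> S \<and> j \<in> S
             then (r(j := r j + \<bar>w\<bar>), c(i := c i + \<bar>w\<bar>), t + 1)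
             else (r, c, t + 1)) G (r, c, t)
     = ((\<lambda>v. r v + sum_list (map (\<lambda>(i, j, w). if j = v then (if i \<in> S \<and> j \<in> S then \<bar>w\<bar> else 0) else 0) G)),
        (\<lambda>v. c v + sum_list (map (\<lambda>(i, j, w). if i = v then (if i \<in> S \<and> j \<in> S then \<bar>w\<bar> else 0) else 0) G)),
        t + length G)"
  by (induction G arbitrary: r c t) (auto simp: fun_eq_iff add.assoc)

lemma prune_fold:
  "fold (\<lambda>i (F, t). if P i then (insert i F, t + 1) else (F, t + 1)) xs (F, t)
     = (F \<union> {i \<in> set xs. P i}, t + length xs)"
  by (induction xs arbitrary: F t) auto

lemma degrees_eq_diag:
  assumes "eulerian_laplacian n L" "graph_of L G" "i < n"
  shows "fst (degrees n G) i = L $$ (i, i)"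
proof -
  have c: "L \<in> carrier_mat n n" using assms(1) by (simp add: eulerian_laplacian_def)
  have "vec_index (L\<^sup>T *\<^sub>v vec n (\<lambda>_. 1)) i = 0"
    using assms(1,3) by (simp add: eulerian_laplacian_def)
  hence "(\<Sum>j\<in>{..<n}. L $$ (j, i)) = 0"
    using c assms(3) by (auto simp: scalar_prod_def lessThan_atLeast0)
  hence "L $$ (i, i) = (\<Sum>j\<in>{..<n} - {i}. - L $$ (j, i))"
    using assms(3) by (simp add: sum.remove[of _ i] sum_negf)
  also have "\<dots> = fst (degrees n G) i"
    unfolding degrees_def degrees_fold
    using graph_of_sum_list_if(1)[OF assms(2) c assms(3), of "\<lambda>(i, j, w). w"] by (simp cong: if_cong)
  finally show ?thesis ..
qed

lemma prune_eq:
  assumes "eulerian_laplacian n L" "graph_of L G" "S \<subseteq> {..<n}"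
  shows "fst (prune n G \<alpha> (fst (degrees n G)) S) =
    S - {i \<in> S. (\<Sum>j\<in>S - {i}. \<bar>L $$ (i, j)\<bar>) > 1 / (1 + \<alpha>) * \<bar>L $$ (i, i)\<bar> \<or>
                (\<Sum>j\<in>S - {i}. \<bar>L $$ (j, i)\<bar>) > 1 / (1 + \<alpha>) * \<bar>L $$ (i, i)\<bar>}"
proof -
  have c: "L \<in> carrier_mat n n" using assms(1) by (simp add: eulerian_laplacian_def)
  let ?f = "\<lambda>(i, j, w). if i \<in> S \<and> j \<in> S then \<bar>w\<bar> else (0::real)"
  let ?r = "\<lambda>v. sum_list (map (\<lambda>(i, j, w). if j = v then (if i \<in> S \<and> j \<in> S then \<bar>w\<bar> else 0) else 0) G)"
  let ?c = "\<lambda>v. sum_list (map (\<lambda>(i, j, w). if i = v then (if i \<in> S \<and> j \<in> S then \<bar>w\<bar> else 0) else 0) G)"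
  have r: "?r v = (\<Sum>j\<in>S - {v}. \<bar>L $$ (v, j)\<bar>)"
    and cc: "?c v = (\<Sum>j\<in>S - {v}. \<bar>L $$ (j, v)\<bar>)" if "v \<in> S" for v
  proof -
    have v: "v < n" using that assms(3) by auto
    have "?r v = (\<Sum>i\<in>{..<n} - {v}. if i \<in> S then \<bar>L $$ (v, i)\<bar> else 0)"
      using graph_of_sum_list_if(2)[OF assms(2) c v, of ?f] that by (simp cong: if_cong)
    also have "\<dots> = (\<Sum>j\<in>S - {v}. \<bar>L $$ (v, j)\<bar>)"
      by (rule sum.mono_neutral_cong_right) (use assms(3) in auto)
    finally show "?r v = (\<Sum>j\<in>S - {v}. \<bar>L $$ (v, j)\<bar>)" .
    have "?c v = (\<Sum>i\<in>{..<n} - {v}. if i \<in> S then \<bar>L $$ (i, v)\<bar> else 0)"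
      using graph_of_sum_list_if(1)[OF assms(2) c v, of ?f] that by (simp cong: if_cong)
    also have "\<dots> = (\<Sum>j\<in>S - {v}. \<bar>L $$ (j, v)\<bar>)"
      by (rule sum.mono_neutral_cong_right) (use assms(3) in auto)
    finally show "?c v = (\<Sum>j\<in>S - {v}. \<bar>L $$ (j, v)\<bar>)" .
  qed
  have "fst (prune n G \<alpha> (fst (degrees n G)) S) =
     {v \<in> {..<n}. v \<in> S \<and> \<not> (?r v > 1 / (1 + \<alpha>) * \<bar>fst (degrees n G) v\<bar> \<or>
                             ?c v > 1 / (1 + \<alpha>) * \<bar>fst (degrees n G) v\<bar>)}"
    unfolding prune_def row_col_sums_def row_col_sums_fold Let_def
    by (simp add: prune_fold lessThan_atLeast0)
  also have "\<dots> = S - {i \<in> S. (\<Sum>j\<in>S - {i}. \<bar>L $$ (i, j)\<bar>) > 1 / (1 + \<alpha>) * \<bar>L $$ (i, i)\<bar> \<or>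
                (\<Sum>j\<in>S - {i}. \<bar>L $$ (j, i)\<bar>) > 1 / (1 + \<alpha>) * \<bar>L $$ (i, i)\<bar>}"
    using assms(3) r cc degrees_eq_diag[OF assms(1,2)] by auto
  finally show ?thesis .
qed

end

(*
  In a random sample S of size k, the expected row and column sums of a vertex of S inside S are at
  most (k - 1) / (n - 1) times its diagonal entry, so by Markov's inequality each vertex of S is
  removed with probability at most 9/32, and fewer than half of S survives with probability at most
  9/16. Hence the loop lasts more than l rounds with probability at most (9/16)^l. A round costs
  O(n + m) steps, which is O(m) because the positive diagonal gives every vertex an outgoing edge.
  The constant C = 2 makes the bound trivial for delta > 1/2, so that otherwise ln (1 / delta) is
  bounded below and absorbs the cost of the setup and of rounding l up.
*)

theory Submission
  imports Defs
begin

section \<open>Pairs and heavy rows in a random \<open>k\<close>-subset\<close>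

text \<open>Deleting \<open>i\<close> and \<open>j\<close> is a bijection onto the
  \<open>(k - 2)\<close>-subsets of \<open>V - {i, j}\<close>. Two applications of the absorption
  identity \<open>Suc_times_binomial\<close> then relate their number to
  \<open>card V choose k\<close>. The product form avoids division and holds for
  \<open>k < 2\<close> too, where both sides vanish.\<close>

lemma card_subsets_containing_pair:
  assumes "finite V" "i \<in> V" "j \<in> V" "i \<noteq> j"
  shows "card {S. S \<subseteq> V \<and> card S = k \<and> i \<in> S \<and> j \<in> S} * (card V * (card V - 1))
           = k * (k - 1) * (card V choose k)"
proof (cases "k \<ge> 2")
  case True
  then obtain l where k: "k = Suc (Suc l)"
    by (metis One_nat_def Suc_1 Suc_le_D Suc_le_mono)
  have "card {i, j} \<le> card V"
    by (rule card_mono) (use assms in auto)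
  then obtain N where N: "card V = Suc (Suc N)"
    using assms(4) by (metis One_nat_def Suc_1 Suc_le_D Suc_le_mono card_2_iff)
  let ?f = "\<lambda>T. insert i (insert j T)"
  let ?B = "{T. T \<subseteq> V - {i, j} \<and> card T = l}"
  have fin: "finite T" if "T \<subseteq> V" for T
    using that assms(1) finite_subset by blast
  have "{S. S \<subseteq> V \<and> card S = k \<and> i \<in> S \<and> j \<in> S} = ?f ` ?B"
  proof (intro equalityI subsetI)
    fix S assume "S \<in> {S. S \<subseteq> V \<and> card S = k \<and> i \<in> S \<and> j \<in> S}"
    then have S: "S \<subseteq> V" "card S = k" "i \<in> S" "j \<in> S" by auto
    have "card (S - {i, j}) = l"
      using S assms(4) k by (subst card_Diff_subset) auto
    then have "S - {i, j} \<in> ?B" using S by auto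
    moreover have "S = ?f (S - {i, j})" using S by auto
    ultimately show "S \<in> ?f ` ?B" by blast
  next
    fix S assume "S \<in> ?f ` ?B"
    then obtain T where T: "T \<subseteq> V - {i, j}" "card T = l" "S = ?f T" by auto
    have "finite T" using T(1) fin by blast
    then have "card S = k" using T assms(4) k by (subst T(3)) (auto simp: card_insert_if)
    then show "S \<in> {S. S \<subseteq> V \<and> card S = k \<and> i \<in> S \<and> j \<in> S}"
      using T assms by auto
  qed
  moreover have "inj_on ?f ?B"
    by (rule inj_onI) (auto simp: set_eq_iff)
  moreover have "card ?B = N choose l"
    using assms N by (subst n_subsets) (auto simp: card_Diff_subset)
  ultimately have c: "card {S. S \<subseteq> V \<and> card S = k \<and> i \<in> S \<and> j \<in> S} = N choose l"
    by (simp add: card_image)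
  have "k * (k - 1) * (card V choose k) = Suc l * (Suc (Suc l) * (Suc (Suc N) choose Suc (Suc l)))"
    by (simp only: k N diff_Suc_1 mult_ac)
  also have "\<dots> = Suc l * (Suc (Suc N) * (Suc N choose Suc l))"
    by (simp only: Suc_times_binomial)
  also have "\<dots> = Suc (Suc N) * (Suc l * (Suc N choose Suc l))"
    by (simp only: mult.left_commute)
  also have "\<dots> = Suc (Suc N) * (Suc N * (N choose l))"
    by (simp only: Suc_times_binomial)
  finally show ?thesis by (simp only: c N diff_Suc_1 mult_ac)
next
  case False
  have "{S. S \<subseteq> V \<and> card S = k \<and> i \<in> S \<and> j \<in> S} = {}"
  proof -
    have "card S \<ge> 2" if "S \<subseteq> V" "i \<in> S" "j \<in> S" for S
    proof -
      have "card {i, j} \<le> card S"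
        by (rule card_mono) (use that assms in \<open>auto intro: finite_subset\<close>)
      then show ?thesis using assms by simp
    qed
    then show ?thesis using False by auto
  qed
  moreover have "k * (k - 1) = 0" using False by (cases k) auto
  ultimately show ?thesis by (simp only: card.empty mult_0)
qed

text \<open>
  Markov's inequality, summed over \<open>i\<close>: two fixed elements lie together in a random
  \<open>k\<close>-subset with probability \<open>k (k - 1) / (n (n - 1))\<close>.
\<close>

lemma sum_card_heavy_rows_le:
  fixes a :: "'a \<Rightarrow> 'a \<Rightarrow> real"
  assumes "finite V" "V \<noteq> {}" "k > 0" "\<beta> > 0"
    and nonneg: "\<And>i j. 0 \<le> a i j"
    and pos: "\<And>i. i \<in> V \<Longrightarrow> 0 < D i"
    and row: "\<And>i. i \<in> V \<Longrightarrow> (\<Sum>j\<in>V - {i}. a i j) \<le> D i"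
  shows "(\<Sum>S\<in>{S. S \<subseteq> V \<and> card S = k}. real (card {i\<in>S. (\<Sum>j\<in>S - {i}. a i j) > 1 / \<beta> * D i}))
           * (real (card V) - 1)
         \<le> \<beta> * (real k * (real k - 1) * real (card V choose k))"
proof -
  define A where "A = {S. S \<subseteq> V \<and> card S = k}"
  \<comment> \<open>The scaling makes \<open>i\<close> heavy in \<open>S\<close> exactly when its
    weights inside \<open>S - {i}\<close> sum to more than 1, while over all of
    \<open>V - {i}\<close> they sum to at most \<open>\<beta>\<close>.\<close>
  define w where "w i j = a i j * \<beta> / D i" for i j
  define n where "n = card V"
  define M where "M = real k * (real k - 1) * real (n choose k)"
  have n: "n > 0" using assms by (simp add: n_def card_gt_0_iff)
  have M: "M \<ge> 0" using assms by (simp add: M_def)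
  have finA: "finite A" using assms by (simp add: A_def)
  have w0: "w i j \<ge> 0" if "i \<in> V" for i j
    using nonneg pos[OF that] assms(4) by (simp add: w_def less_imp_le)
  \<comment> \<open>Markov's inequality for a fixed \<open>S\<close>: each heavy \<open>i\<close> is
    charged to its weights, which sum to at least 1. Writing membership in \<open>S\<close> as an
    indicator leaves index sets that do not depend on \<open>S\<close>, so the sums can be exchanged
    later.\<close>
  have one: "real (card {i\<in>S. (\<Sum>j\<in>S - {i}. a i j) > 1 / \<beta> * D i})
      \<le> (\<Sum>i\<in>V. \<Sum>j\<in>V - {i}. if i \<in> S \<and> j \<in> S then w i j else 0)" if "S \<in> A" for S
  proof -
    have S: "S \<subseteq> V" "finite S" using that assms(1) finite_subset by (auto simp: A_def)
    have "real (card {i\<in>S. (\<Sum>j\<in>S - {i}. a i j) > 1 / \<beta> * D i})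
        = (\<Sum>i\<in>{i\<in>S. (\<Sum>j\<in>S - {i}. a i j) > 1 / \<beta> * D i}. 1)" by simp
    also have "\<dots> \<le> (\<Sum>i\<in>{i\<in>S. (\<Sum>j\<in>S - {i}. a i j) > 1 / \<beta> * D i}. \<Sum>j\<in>S - {i}. w i j)"
    proof (rule sum_mono)
      fix i assume i: "i \<in> {i\<in>S. (\<Sum>j\<in>S - {i}. a i j) > 1 / \<beta> * D i}"
      have "D i > 0" using i S pos by auto
      then have "1 \<le> (\<Sum>j\<in>S - {i}. a i j) * \<beta> / D i"
        using i assms(4) by (simp add: field_simps)
      also have "\<dots> = (\<Sum>j\<in>S - {i}. w i j)"
        by (simp add: w_def sum_divide_distrib sum_distrib_right)
      finally show "1 \<le> (\<Sum>j\<in>S - {i}. w i j)" .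
    qed
    also have "\<dots> \<le> (\<Sum>i\<in>S. \<Sum>j\<in>S - {i}. w i j)"
      by (rule sum_mono2) (use S w0 in \<open>auto intro!: sum_nonneg\<close>)
    also have "\<dots> = (\<Sum>i\<in>S. \<Sum>j\<in>V - {i}. if i \<in> S \<and> j \<in> S then w i j else 0)"
      by (intro sum.cong refl sum.mono_neutral_cong_left) (use S assms(1) in auto)
    also have "\<dots> \<le> (\<Sum>i\<in>V. \<Sum>j\<in>V - {i}. if i \<in> S \<and> j \<in> S then w i j else 0)"
      by (rule sum_mono2) (use S w0 assms(1) in \<open>auto intro!: sum_nonneg\<close>)
    finally show ?thesis .
  qed
  \<comment> \<open>Every ordered pair lies in equally many samples. The factor
    \<open>real n - 1\<close> is kept rather than divided out because it vanishes when
    \<open>V\<close> is a singleton.\<close>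
  have pair: "real (card {S\<in>A. i \<in> S \<and> j \<in> S}) * (n * (real n - 1)) = M"
    if "i \<in> V" "j \<in> V - {i}" for i j
  proof -
    have "card {S\<in>A. i \<in> S \<and> j \<in> S} * (n * (n - 1)) = k * (k - 1) * (n choose k)"
      using card_subsets_containing_pair[of V i j k] that assms(1)
      by (auto simp: A_def n_def conj_ac)
    then have "real (card {S\<in>A. i \<in> S \<and> j \<in> S} * (n * (n - 1))) = real (k * (k - 1) * (n choose k))"
      by (rule arg_cong)
    then show ?thesis using n assms(3) by (simp add: M_def of_nat_diff)
  qed
  let ?X = "(\<Sum>S\<in>A. real (card {i\<in>S. (\<Sum>j\<in>S - {i}. a i j) > 1 / \<beta> * D i}))"
  have "?X \<le> (\<Sum>S\<in>A. \<Sum>i\<in>V. \<Sum>j\<in>V - {i}. if i \<in> S \<and> j \<in> S then w i j else 0)"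
    by (rule sum_mono) (rule one)
  also have "\<dots> = (\<Sum>i\<in>V. \<Sum>S\<in>A. \<Sum>j\<in>V - {i}. if i \<in> S \<and> j \<in> S then w i j else 0)"
    by (rule sum.swap)
  also have "\<dots> = (\<Sum>i\<in>V. \<Sum>j\<in>V - {i}. \<Sum>S\<in>A. if i \<in> S \<and> j \<in> S then w i j else 0)"
    by (intro sum.cong refl sum.swap)
  also have "\<dots> = (\<Sum>i\<in>V. \<Sum>j\<in>V - {i}. w i j * card {S\<in>A. i \<in> S \<and> j \<in> S})"
    by (intro sum.cong refl) (simp add: sum.If_cases[OF finA] Int_def mult.commute)
  finally have "?X \<le> (\<Sum>i\<in>V. \<Sum>j\<in>V - {i}. w i j * card {S\<in>A. i \<in> S \<and> j \<in> S})" .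
  then have "?X * (n * (real n - 1))
      \<le> (\<Sum>i\<in>V. \<Sum>j\<in>V - {i}. w i j * card {S\<in>A. i \<in> S \<and> j \<in> S}) * (n * (real n - 1))"
    using n by (intro mult_right_mono) auto
  also have "\<dots> = (\<Sum>i\<in>V. \<Sum>j\<in>V - {i}. w i j * (card {S\<in>A. i \<in> S \<and> j \<in> S} * (n * (real n - 1))))"
    by (simp add: sum_distrib_right mult.assoc)
  also have "\<dots> = (\<Sum>i\<in>V. \<Sum>j\<in>V - {i}. w i j * M)"
    by (intro sum.cong refl) (simp only: pair)
  also have "\<dots> \<le> (\<Sum>i\<in>V. \<beta> * M)"
  proof (rule sum_mono)
    fix i assume i: "i \<in> V"
    have "(\<Sum>j\<in>V - {i}. w i j) = (\<Sum>j\<in>V - {i}. a i j) * \<beta> / D i"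
      by (simp add: w_def sum_divide_distrib sum_distrib_right)
    also have "\<dots> \<le> \<beta>"
      using row[OF i] pos[OF i] assms(4) by (simp add: field_simps)
    finally show "(\<Sum>j\<in>V - {i}. w i j * M) \<le> \<beta> * M"
      using M by (simp add: sum_distrib_right[symmetric] mult_right_mono)
  qed
  also have "\<dots> = n * (\<beta> * M)" by (simp add: n_def)
  finally have "n * (?X * (real n - 1)) \<le> n * (\<beta> * M)"
    by (simp add: mult_ac)
  then have "?X * (real n - 1) \<le> \<beta> * M" using n by simp
  then show ?thesis by (simp add: A_def n_def M_def)
qed

section \<open>Row and column sums, number of edges, and rounding of the sample size\<close>

text \<open>The off-diagonal entries all have the same sign, so the vanishing row and column sums
  pass to absolute values. This lets the bound on heavy rows apply to both \<open>L\<close> and its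
  transpose, with \<open>D i = L $$ (i, i)\<close>.\<close>

lemma eulerian_laplacian_sums:
  assumes "eulerian_laplacian n L" "i < n"
  shows "(\<Sum>j\<in>{..<n} - {i}. \<bar>L $$ (i, j)\<bar>) = L $$ (i, i)"
    and "(\<Sum>j\<in>{..<n} - {i}. \<bar>L $$ (j, i)\<bar>) = L $$ (i, i)"
proof -
  have c: "L \<in> carrier_mat n n" and le: "\<And>i j. i < n \<Longrightarrow> j < n \<Longrightarrow> i \<noteq> j \<Longrightarrow> L $$ (i, j) \<le> 0"
    using assms(1) by (auto simp: eulerian_laplacian_def)
  have "vec_index (L *\<^sub>v vec n (\<lambda>_. 1)) i = 0" "vec_index (L\<^sup>T *\<^sub>v vec n (\<lambda>_. 1)) i = 0"
    using assms by (simp_all add: eulerian_laplacian_def)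
  hence "(\<Sum>j\<in>{..<n}. L $$ (i, j)) = 0" "(\<Sum>j\<in>{..<n}. L $$ (j, i)) = 0"
    using c assms(2) by (auto simp: scalar_prod_def lessThan_atLeast0)
  hence s: "L $$ (i, i) = (\<Sum>j\<in>{..<n} - {i}. - L $$ (i, j))" "L $$ (i, i) = (\<Sum>j\<in>{..<n} - {i}. - L $$ (j, i))"
    using assms(2) by (simp_all add: sum.remove[of _ i] sum_negf)
  show "(\<Sum>j\<in>{..<n} - {i}. \<bar>L $$ (i, j)\<bar>) = L $$ (i, i)"
    unfolding s(1) by (intro sum.cong refl) (use le assms(2) in \<open>auto simp: abs_of_nonpos\<close>)
  show "(\<Sum>j\<in>{..<n} - {i}. \<bar>L $$ (j, i)\<bar>) = L $$ (i, i)"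
    unfolding s(2) by (intro sum.cong refl) (use le assms(2) in \<open>auto simp: abs_of_nonpos\<close>)
qed

text \<open>A positive column sum forces a nonzero off-diagonal entry in the column of
  \<open>i\<close>, that is, an edge leaving \<open>i\<close>. Hence the sources of the edges cover
  all vertices.\<close>

lemma length_graph_of_ge:
  assumes "eulerian_laplacian n L" "\<forall>i<n. L $$ (i, i) > 0" "graph_of L G"
  shows "n \<le> length G"
proof -
  have c: "dim_row L = n" using assms(1) by (auto simp: eulerian_laplacian_def)
  have "\<exists>j<n. j \<noteq> i \<and> L $$ (j, i) \<noteq> 0" if "i < n" for i
  proof (rule ccontr)
    assume "\<not> ?thesis"
    then have "(\<Sum>j\<in>{..<n} - {i}. \<bar>L $$ (j, i)\<bar>) = 0" by (intro sum.neutral) auto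
    then show False using eulerian_laplacian_sums(2)[OF assms(1) that] assms(2) that by auto
  qed
  then have "{..<n} \<subseteq> fst ` set G"
    using assms(3) c by (force simp: graph_of_def image_iff)
  then have "card {..<n} \<le> card (fst ` set G)" by (intro card_mono) auto
  also have "\<dots> \<le> card (set G)" by (rule card_image_le) simp
  also have "\<dots> \<le> length G" by (rule card_length)
  finally show ?thesis by simp
qed

text \<open>The last bound absorbs the rounding up. Without rounding,
  \<open>(1 + \<alpha>) * k\<close> would be \<open>n / 8\<close>; the extra factor 9/8 in
  \<open>9 / 64\<close> is the value of \<open>n / (n - 1)\<close> at \<open>n = 9\<close>, the
  smallest \<open>n\<close> for which the sample can have two elements.\<close>

lemma sample_size_bounds:
  assumes "n > 0" "\<alpha> \<ge> 0"
  shows "0 < sample_size n \<alpha>" "sample_size n \<alpha> \<le> n"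
    "real n / (8 * (1 + \<alpha>)) \<le> sample_size n \<alpha>"
    "(1 + \<alpha>) * (real (sample_size n \<alpha>) - 1) \<le> 9 / 64 * (real n - 1)"
proof -
  define x where "x = real n / (8 * (1 + \<alpha>))"
  have x: "x > 0" "x \<le> n" "8 * (1 + \<alpha>) * x = n"
    using assms by (auto simp: x_def field_simps)
  have k: "real (sample_size n \<alpha>) = of_int \<lceil>x\<rceil>"
    using x by (simp add: sample_size_def x_def)
  have up: "real (sample_size n \<alpha>) < x + 1" unfolding k by linarith
  show "0 < sample_size n \<alpha>" using x by (simp add: sample_size_def x_def)
  show "real n / (8 * (1 + \<alpha>)) \<le> sample_size n \<alpha>" using k by (simp add: x_def)
  have "\<lceil>x\<rceil> \<le> int n" using x(2) by (simp add: ceiling_le_iff)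
  then have "real (sample_size n \<alpha>) \<le> n" unfolding k by linarith
  then show "sample_size n \<alpha> \<le> n" by simp
  show "(1 + \<alpha>) * (real (sample_size n \<alpha>) - 1) \<le> 9 / 64 * (real n - 1)"
  proof (cases "sample_size n \<alpha> \<le> 1")
    case True
    then have "(1 + \<alpha>) * (real (sample_size n \<alpha>) - 1) \<le> 0"
      using assms by (intro mult_nonneg_nonpos) auto
    also have "0 \<le> 9 / 64 * (real n - 1)" using assms by simp
    finally show ?thesis .
  next
    case False
    \<comment> \<open>A sample of at least two vertices means that a number above 1 was rounded up,
      which forces \<open>n > 8\<close>.\<close>
    then have "x > 1" using up by linarith
    have "8 * 1 < 8 * ((1 + \<alpha>) * x)"
      using assms \<open>x > 1\<close> by (smt (verit) mult_le_cancel_right1)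
    also have "\<dots> = n" using x(3) by (simp only: mult.assoc)
    finally have n: "n \<ge> 9" by simp
    have "(1 + \<alpha>) * (real (sample_size n \<alpha>) - 1) \<le> (1 + \<alpha>) * x"
      using up assms by (intro mult_left_mono) auto
    also have "\<dots> = n / 8" using x(3) by (simp add: algebra_simps)
    also have "\<dots> \<le> 9 / 64 * (real n - 1)" using n by simp
    finally show ?thesis .
  qed
qed

section \<open>A single round\<close>

text \<open>The survivors passed the test with sums over all of \<open>S\<close>; restricting sums
  of absolute values to the survivors can only decrease them.\<close>

lemma rcdd_prune:
  assumes "eulerian_laplacian n L" "graph_of L G" "S \<subseteq> {..<n}"
  shows "rcdd L \<alpha> (fst (prune n G \<alpha> (fst (degrees n G)) S))"
proof -
  let ?F = "fst (prune n G \<alpha> (fst (degrees n G)) S)"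
  have c: "dim_row L = n" using assms(1) by (auto simp: eulerian_laplacian_def)
  have fin: "finite S" using assms(3) finite_subset by blast
  have F: "?F \<subseteq> S" unfolding prune_eq[OF assms] by blast
  have mono: "(\<Sum>j\<in>?F - {i}. \<bar>f j\<bar>) \<le> (\<Sum>j\<in>S - {i}. \<bar>f j\<bar>)" for f :: "nat \<Rightarrow> real" and i
    by (rule sum_mono2) (use F fin in auto)
  have "(\<Sum>j\<in>S - {i}. \<bar>L $$ (i, j)\<bar>) \<le> 1 / (1 + \<alpha>) * \<bar>L $$ (i, i)\<bar> \<and>
        (\<Sum>j\<in>S - {i}. \<bar>L $$ (j, i)\<bar>) \<le> 1 / (1 + \<alpha>) * \<bar>L $$ (i, i)\<bar>" if "i \<in> ?F" for i
    using that unfolding prune_eq[OF assms] by auto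
  then show ?thesis
    unfolding rcdd_def c using F assms(3) order_trans[OF mono] by (meson subset_trans)
qed

text \<open>In a bad sample at least half of the \<open>k\<close> vertices are heavy in a row or a
  column. Rows and columns each account for at most \<open>9 / 64 * k\<close> heavy vertices on
  average, so Markov's inequality over the samples gives
  \<open>(9 / 32 * k) / (k / 2) = 9 / 16\<close>.\<close>

lemma card_bad_samples_le:
  assumes eul: "eulerian_laplacian n L" and diag: "\<forall>i<n. L $$ (i, i) > 0"
    and G: "graph_of L G" and "\<alpha> \<ge> 0" and "n > 0"
  defines "A \<equiv> {S. S \<subseteq> {..<n} \<and> card S = sample_size n \<alpha>}"
  shows "card {S\<in>A. real (card (fst (prune n G \<alpha> (fst (degrees n G)) S))) < real n / (16 * (1 + \<alpha>))}
           \<le> 9 / 16 * card A"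
proof -
  define k where "k = sample_size n \<alpha>"
  define r where "r S = {i\<in>S. (\<Sum>j\<in>S - {i}. \<bar>L $$ (i, j)\<bar>) > 1 / (1 + \<alpha>) * L $$ (i, i)}" for S
  define c where "c S = {i\<in>S. (\<Sum>j\<in>S - {i}. \<bar>L $$ (j, i)\<bar>) > 1 / (1 + \<alpha>) * L $$ (i, i)}" for S
  define B where "B = {S\<in>A. real (card (fst (prune n G \<alpha> (fst (degrees n G)) S))) < real n / (16 * (1 + \<alpha>))}"
  note k = sample_size_bounds[OF \<open>n > 0\<close> \<open>\<alpha> \<ge> 0\<close>, folded k_def]
  have finA: "finite A" by (simp add: A_def)
  have cardA: "card A = n choose k" by (simp add: A_def k_def n_subsets)
  \<comment> \<open>A single vertex would have diagonal entry 0, the value of an empty sum.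
    Excluding this case allows cancelling \<open>real n - 1\<close> below.\<close>
  have n2: "n \<noteq> 1"
  proof
    assume "n = 1"
    then show False using eulerian_laplacian_sums(1)[OF eul, of 0] diag by (auto simp: lessThan_Suc)
  qed
  have half: "k / 2 \<le> real (card (r S)) + real (card (c S))" if "S \<in> B" for S
  proof -
    have S: "S \<subseteq> {..<n}" "card S = k" "finite S"
      using that finite_subset[of S "{..<n}"] by (auto simp: B_def A_def k_def)
    have "fst (prune n G \<alpha> (fst (degrees n G)) S) = S - (r S \<union> c S)"
      unfolding prune_eq[OF eul G S(1)] r_def c_def using diag S(1)
      by (auto simp: abs_of_pos subset_iff)
    then have "real (card (S - (r S \<union> c S))) < real n / (16 * (1 + \<alpha>))"
      using that by (simp add: B_def)
    also have "\<dots> = (n / (8 * (1 + \<alpha>))) / 2" by simp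
    also have "\<dots> \<le> k / 2" by (rule divide_right_mono[OF k(3)]) simp
    finally have 1: "real (card (S - (r S \<union> c S))) < k / 2" .
    have "card S \<le> card (S - (r S \<union> c S)) + card (r S \<union> c S)"
      using diff_card_le_card_Diff[of "r S \<union> c S" S] S(3) by (simp add: r_def c_def)
    also have "\<dots> \<le> card (S - (r S \<union> c S)) + (card (r S) + card (c S))"
      by (simp add: card_Un_le)
    finally show ?thesis using 1 S(2) by linarith
  qed
  \<comment> \<open>Stated for a general \<open>a\<close> so as to serve for both the entries
    \<open>(i, j)\<close> and the entries \<open>(j, i)\<close>.\<close>
  have bound: "(\<Sum>S\<in>A. real (card {i\<in>S. (\<Sum>j\<in>S - {i}. a i j) > 1 / (1 + \<alpha>) * L $$ (i, i)}))
       \<le> 9 / 64 * (k * card A)"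
    if nn: "\<And>i j. 0 \<le> a i j" and row: "\<And>i. i < n \<Longrightarrow> (\<Sum>j\<in>{..<n} - {i}. a i j) = L $$ (i, i)"
    for a :: "nat \<Rightarrow> nat \<Rightarrow> real"
  proof -
    let ?X = "(\<Sum>S\<in>A. real (card {i\<in>S. (\<Sum>j\<in>S - {i}. a i j) > 1 / (1 + \<alpha>) * L $$ (i, i)}))"
    have "?X * (real n - 1) \<le> (1 + \<alpha>) * (real k * (real k - 1) * real (n choose k))"
      using sum_card_heavy_rows_le[of "{..<n}" k "1 + \<alpha>" a "\<lambda>i. L $$ (i, i)"]
        k(1) diag row nn \<open>\<alpha> \<ge> 0\<close> \<open>n > 0\<close>
      by (simp add: A_def k_def[symmetric] lessThan_empty_iff)
    also have "\<dots> = ((1 + \<alpha>) * (real k - 1)) * (k * card A)" by (simp add: cardA)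
    also have "\<dots> \<le> (9 / 64 * (real n - 1)) * (k * card A)"
      by (rule mult_right_mono[OF k(4)]) simp
    also have "\<dots> = 9 / 64 * (k * card A) * (real n - 1)" by simp
    finally show ?thesis using n2 \<open>n > 0\<close> by simp
  qed
  have "k / 2 * card B = (\<Sum>S\<in>B. k / 2)" by simp
  also have "\<dots> \<le> (\<Sum>S\<in>B. real (card (r S)) + real (card (c S)))"
    by (rule sum_mono) (rule half)
  also have "\<dots> \<le> (\<Sum>S\<in>A. real (card (r S)) + real (card (c S)))"
    by (rule sum_mono2) (use finA in \<open>auto simp: B_def\<close>)
  also have "\<dots> \<le> 9 / 64 * (k * card A) + 9 / 64 * (k * card A)"
    unfolding sum.distrib r_def c_def
    by (intro add_mono bound) (auto simp: eulerian_laplacian_sums[OF eul])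
  finally have "k * real (card B) \<le> k * (9 / 16 * card A)" by simp
  then have "real (card B) \<le> 9 / 16 * card A" using k(1) by simp
  then show ?thesis by (simp add: B_def)
qed

section \<open>Success probability of the loop\<close>

text \<open>Sampling from a nonempty finite set loses no mass, so the bind is one over a
  \<open>pmf\<close> and the measure is a finite average, even if \<open>f\<close> itself loses
  mass.\<close>

lemma measure_bind_spmf_of_set:
  assumes "finite A" "A \<noteq> {}"
  shows "measure (measure_spmf (bind_spmf (spmf_of_set A) f)) X
           = (\<Sum>a\<in>A. measure (measure_spmf (f a)) X) / card A"
proof -
  have "bind_spmf (spmf_of_set A) f = bind_pmf (pmf_of_set A) f"
    using assms by (metis bind_spmf_of_pmf spmf_of_pmf_pmf_of_set)
  then have "measure (measure_spmf (bind_spmf (spmf_of_set A) f)) X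
      = (\<integral>a. measure (measure_spmf (f a)) X \<partial>measure_pmf (pmf_of_set A))"
    by (simp add: measure_spmf_bind_pmf o_def
        measure_pmf.measure_bind[where N="count_space UNIV"] space_subprob_algebra)
  then show ?thesis using assms by (simp add: integral_pmf_of_set)
qed

lemma snd_prune: "snd (prune n G \<alpha> d S) = 4 * n + length G"
  unfolding prune_def row_col_sums_def row_col_sums_fold Let_def
  by (simp add: prune_fold)

text \<open>Induction on the number \<open>l\<close> of further rounds allowed; the bound for
  \<open>l = 0\<close> is trivial. A round costs at most \<open>7 * n + length G\<close>:
  \<open>n\<close> for the loop test, at most \<open>2 * n\<close> for the draw,
  \<open>4 * n + length G\<close> for the removal. The condition on \<open>F\<close> covers both
  branches: a set returned at once is RCDD, and a set that is too small is replaced.\<close>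

lemma sample_loop_success_ge:
  assumes eul: "eulerian_laplacian n L" and diag: "\<forall>i<n. L $$ (i, i) > 0"
    and G: "graph_of L G" and \<alpha>: "\<alpha> \<ge> 0" and n: "n > 0"
    and F: "rcdd L \<alpha> F \<or> real (card F) < real n / (16 * (1 + \<alpha>))"
  shows "measure (measure_spmf (sample_loop n G \<alpha> (fst (degrees n G)) F t))
      {(F', t'). t' \<le> t + n + l * (7 * n + length G) \<and>
               rcdd L \<alpha> F' \<and> real (card F') \<ge> real n / (16 * (1 + \<alpha>))}
      \<ge> 1 - (9 / 16) ^ l"
  using F
proof (induction l arbitrary: F t)
  case 0
  then show ?case by simp
next
  case (Suc l)
  define d where "d = fst (degrees n G)"
  define A where "A = {S. S \<subseteq> {..<n} \<and> card S = sample_size n \<alpha>}"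
  define big where "big F \<longleftrightarrow> real (card F) \<ge> real n / (16 * (1 + \<alpha>))" for F :: "nat set"
  \<comment> \<open>The time budget \<open>b\<close> is a parameter, so that success of the
    recursive call within its own budget can be enlarged to the budget of the current call.\<close>
  define X where "X b = {(F', t'). t' \<le> b \<and> rcdd L \<alpha> F' \<and> real (card F') \<ge> real n / (16 * (1 + \<alpha>))}"
    for b :: nat
  have return: "measure (measure_spmf (sample_loop n G \<alpha> d F t)) (X b) = 1"
    if "rcdd L \<alpha> F" "big F" "t + n \<le> b" for F t b
    using that by (subst sample_loop.simps) (simp add: X_def big_def measure_spmf_return_spmf measure_return)
  show ?case
  proof (cases "big F")
    case True
    then have "rcdd L \<alpha> F" using Suc.prems by (auto simp: big_def)
    then show ?thesis using return[OF _ True, of t "t + n + Suc l * (7 * n + length G)"]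
      by (simp add: X_def d_def)
  next
    case False
    define p where "p S = fst (prune n G \<alpha> d S)" for S
    \<comment> \<open>The counter after one round. It is the same for every sample, as the cost of
      the removal depends only on \<open>n\<close> and \<open>G\<close>.\<close>
    define s where "s = t + n + (n + sample_size n \<alpha>) + (4 * n + length G)"
    let ?b = "t + n + Suc l * (7 * n + length G)"
    note k = sample_size_bounds[OF n \<alpha>]
    have s: "s + n + l * (7 * n + length G) \<le> ?b" using k(2) by (simp add: s_def)
    have finA: "finite A" by (simp add: A_def)
    have "card A = n choose sample_size n \<alpha>" by (simp add: A_def n_subsets)
    then have A0: "card A > 0" using k(2) by simp
    then have "A \<noteq> {}" by auto
    \<comment> \<open>A good sample ends the loop with certainty; only a bad one is left with the
      failure bound from the induction hypothesis.\<close>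
    have step: "1 - (if big (p S) then 0 else (9 / 16) ^ l)
        \<le> measure (measure_spmf (sample_loop n G \<alpha> d (p S) s)) (X ?b)" if "S \<in> A" for S
    proof -
      have r: "rcdd L \<alpha> (p S)" unfolding p_def d_def
        by (rule rcdd_prune[OF eul G]) (use that in \<open>auto simp: A_def\<close>)
      show ?thesis
      proof (cases "big (p S)")
        case True
        then show ?thesis using return[OF r True, of s ?b] s by simp
      next
        case False
        have "1 - (9 / 16) ^ l \<le> measure (measure_spmf (sample_loop n G \<alpha> d (p S) s))
            (X (s + n + l * (7 * n + length G)))"
          using Suc.IH[of "p S" s] r by (simp add: X_def d_def)
        also have "\<dots> \<le> measure (measure_spmf (sample_loop n G \<alpha> d (p S) s)) (X ?b)"
          by (rule measure_spmf.finite_measure_mono) (use s in \<open>auto simp: X_def\<close>)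
        finally show ?thesis using False by simp
      qed
    qed
    have bad: "real (card {S\<in>A. \<not> big (p S)}) \<le> 9 / 16 * card A"
      using card_bad_samples_le[OF eul diag G \<alpha> n] by (simp add: A_def big_def p_def d_def not_le)
    have "sample_loop n G \<alpha> d F t = bind_spmf (spmf_of_set A) (\<lambda>S. sample_loop n G \<alpha> d (p S) s)"
      using False by (subst sample_loop.simps)
        (simp add: A_def big_def not_le p_def s_def case_prod_unfold snd_prune)
    then have "measure (measure_spmf (sample_loop n G \<alpha> d F t)) (X ?b)
        = (\<Sum>S\<in>A. measure (measure_spmf (sample_loop n G \<alpha> d (p S) s)) (X ?b)) / card A"
      using measure_bind_spmf_of_set[OF finA \<open>A \<noteq> {}\<close>] by simp
    also have "\<dots> \<ge> (\<Sum>S\<in>A. 1 - (if big (p S) then 0 else (9 / 16) ^ l)) / card A"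
      by (intro divide_right_mono sum_mono step) auto
    also have "(\<Sum>S\<in>A. 1 - (if big (p S) then 0 else (9 / 16) ^ l))
        = card A - (9 / 16) ^ l * real (card {S\<in>A. \<not> big (p S)})"
      by (simp add: sum_subtractf sum.If_cases[OF finA] Int_def mult.commute)
    \<comment> \<open>Bad samples make up at most 9/16 of \<open>A\<close>, which contributes the
      additional factor \<open>9 / 16\<close>.\<close>
    also have "\<dots> / card A \<ge> (card A - (9 / 16) ^ l * (9 / 16 * card A)) / card A"
      by (intro divide_right_mono diff_left_mono mult_left_mono bad) auto
    also have "(card A - (9 / 16) ^ l * (9 / 16 * card A)) / card A = 1 - (9 / 16) ^ Suc l"
      using A0 by (simp add: field_simps)
    finally show ?thesis by (simp add: X_def d_def)
  qed
qed

section \<open>Choice of the number of rounds and of the constants\<close>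

theorem theoremA1:
  shows "\<exists>C>0. \<exists>K>0. \<forall>(n::nat) (m::nat) (L::real mat) (G::edge_list) (\<alpha>::real) (\<delta>::real).
    eulerian_laplacian n L \<longrightarrow> (\<forall>i<n. L $$ (i, i) > 0) \<longrightarrow>
    graph_of L G \<longrightarrow> length G = m \<longrightarrow> \<alpha> \<ge> 0 \<longrightarrow> 0 < \<delta> \<longrightarrow> \<delta> < 1 \<longrightarrow>
    measure (measure_spmf (find_rcdd_block n G \<alpha>))
      {(F, t). real t \<le> K * (real m * ln (1 / \<delta>)) \<and>
               rcdd L \<alpha> F \<and> real (card F) \<ge> real n / (16 * (1 + \<alpha>))}
      \<ge> 1 - C * \<delta>"
proof -
  \<comment> \<open>Each round multiplies the failure bound by \<open>exp (- q)\<close>, so about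
    \<open>ln (1 / \<delta>) / q\<close> rounds bring it down to \<open>\<delta>\<close>.\<close>
  define q where "q = ln (16 / 9 :: real)"
  \<comment> \<open>The total time will be at most \<open>m * (4 + 8 * l)\<close> with
    \<open>l \<le> lg / q + 1\<close>, hence at most \<open>m * (12 + 8 * lg / q)\<close>; the
    constant 12 is at most \<open>12 / ln 2 * lg\<close> because
    \<open>lg \<ge> ln 2\<close>.\<close>
  define K where "K = 8 / q + 12 / ln (2 :: real)"
  have q: "q > 0" by (simp add: q_def)
  have K: "K > 0" using q by (simp add: K_def add_pos_pos)
  have "1 - 2 * \<delta> \<le> measure (measure_spmf (find_rcdd_block n G \<alpha>))
      {(F, t). real t \<le> K * (real m * ln (1 / \<delta>)) \<and>
               rcdd L \<alpha> F \<and> real (card F) \<ge> real n / (16 * (1 + \<alpha>))}" (is "_ \<le> measure ?M ?X")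
    if eul: "eulerian_laplacian n L" and diag: "\<forall>i<n. L $$ (i, i) > 0" and G: "graph_of L G"
      and m: "length G = m" and \<alpha>: "\<alpha> \<ge> 0" and \<delta>: "0 < \<delta>" "\<delta> < 1" for n m L G \<alpha> \<delta>
  proof -
    have "snd (degrees n G) = n + m"
      unfolding degrees_def degrees_fold by (simp add: m)
    \<comment> \<open>The degrees cost \<open>n + m\<close>; the other \<open>n\<close> is for
      setting up the initial empty set.\<close>
    then have start: "find_rcdd_block n G \<alpha> = sample_loop n G \<alpha> (fst (degrees n G)) {} (2 * n + m)"
      by (simp add: find_rcdd_block_def case_prod_unfold mult_2 add_ac)
    consider "n = 0" | "\<delta> > 1 / 2" | "n > 0" "\<delta> \<le> 1 / 2" by linarith
    then show ?thesis
    proof cases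
      \<comment> \<open>With no vertices the threshold is 0 and the empty set is returned at once.
        The time bound is then 0 as well, and the counter meets it exactly.\<close>
      case 1
      have "dim_row L = 0" using eul 1 by (auto simp: eulerian_laplacian_def)
      then have "set G = {}" using G by (auto simp: graph_of_def)
      then have "m = 0" using m by simp
      then have "find_rcdd_block n G \<alpha> = return_spmf ({}, 0)"
        unfolding start by (subst sample_loop.simps) (simp add: 1)
      then have "measure ?M ?X = 1"
        using 1 \<open>m = 0\<close> by (simp add: measure_spmf_return_spmf measure_return rcdd_def)
      then show ?thesis using \<delta> by simp
    next
      case 2
      then have "1 - 2 * \<delta> \<le> 0" by simp
      then show ?thesis using measure_nonneg order_trans by blast
    next
      case 3
      define lg where "lg = ln (1 / \<delta>)"
      define l where "l = nat \<lceil>lg / q\<rceil>"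
      have lg: "lg \<ge> ln 2" unfolding lg_def using \<delta> 3 by (subst ln_le_cancel_iff) (auto simp: field_simps)
      then have "lg > 0" using ln_gt_zero[of "2::real"] by linarith
      then have l: "lg / q \<le> l" "l \<le> lg / q + 1" using q by (auto simp: l_def)
      have "lg \<le> l * q" using l(1) q by (simp add: field_simps)
      then have "exp (- (l * q)) \<le> exp (- lg)" by simp
      also have "exp (- lg) = \<delta>" using \<delta> by (simp add: lg_def ln_div)
      also have "exp (- (l * q)) = (9 / 16) ^ l"
        by (simp add: exp_minus exp_of_nat_mult q_def power_divide)
      finally have fail: "(9 / 16) ^ l \<le> \<delta>" .
      have nm: "n \<le> m" using length_graph_of_ge[OF eul diag G] m by simp
      have time: "real t \<le> K * (m * lg)" if "t \<le> (2 * n + m) + n + l * (7 * n + m)" for t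
      proof -
        have "l * (7 * n + m) \<le> l * (8 * m)" using nm by (intro mult_le_mono2) linarith
        then have "t \<le> 4 * m + l * (8 * m)" using that nm by linarith
        then have "real t \<le> real (4 * m + l * (8 * m))" by (rule of_nat_mono)
        also have "\<dots> = m * (4 + 8 * l)" by (simp add: algebra_simps)
        also have "\<dots> = real m * (4 + 8 * real l)" by simp
        also have "\<dots> \<le> m * (K * lg)"
        proof (rule mult_left_mono)
          have "12 \<le> 12 / ln 2 * lg" using lg by (simp add: field_simps)
          moreover have "8 * l \<le> 8 / q * lg + 8" using l(2) by simp
          ultimately show "4 + 8 * real l \<le> K * lg" by (simp add: K_def algebra_simps)
        qed simp
        finally show ?thesis by (simp add: mult_ac)
      qed
      have "real (card ({} :: nat set)) < real n / (16 * (1 + \<alpha>))" using 3 \<alpha> by simp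
      then have "1 - (9 / 16) ^ l \<le> measure ?M {(F', t'). t' \<le> (2 * n + m) + n + l * (7 * n + m) \<and>
               rcdd L \<alpha> F' \<and> real (card F') \<ge> real n / (16 * (1 + \<alpha>))}"
        using sample_loop_success_ge[OF eul diag G \<alpha> \<open>n > 0\<close>, where F = "{}" and t = "2 * n + m" and l = l]
        unfolding start m by blast
      also have "\<dots> \<le> measure ?M ?X"
        by (rule measure_spmf.finite_measure_mono) (use time in \<open>auto simp: lg_def\<close>)
      \<comment> \<open>The failure probability is at most \<open>\<delta>\<close> here, within the
        allowed \<open>2 * \<delta>\<close>.\<close>
      finally show ?thesis using fail \<delta> by linarith
    qed
  qed
  then show ?thesis using K by (intro exI[of _ 2] exI[of _ K] conjI) auto
qed

end
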